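(* Let $G$ be a finite simple bipartite graph with vertices $v_1,\dots,v_n$ and let $C$ be a vertex cover of $G$. Then $$\sum_{v_i\in C}\mathcal{E}_G(v_i)\geq\frac{1}{2}\mathcal{E}(G).$$
   Context: Let $A$ be the adjacency matrix of $G$ and $|A|=(AA^* )^{1/2}$. The energy of the vertex $v_i$ is $\mathcal{E}_G(v_i)=|A|_{ii}$. The energy of $G$ is $\mathcal{E}(G)=\sum_{i=1}^n|\lambda_i|=\mathrm{Tr}(|A|)=\sum_{i=1}^n\mathcal{E}_G(v_i)$, where $\lambda_1,\dots,\lambda_n$ are the eigenvalues of $A$ with multiplicity. A vertex cover is a set of vertices containing at least one endpoint of every edge. *)

theory Defs
  imports
    "Jordan_Normal_Form.Schur_Decomposition"
    "HOL-Computational_Algebra.Fundamental_Theorem_Algebra"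
    "Graph_Theory.Pair_Digraph"
begin

(* A finite simple graph is a "pair_graph": the arc set is a finite symmetric loop-free
   relation, so the undirected edge {u, v} is encoded by both arcs (u, v) and (v, u). *)

definition bipartite :: "'a pair_pre_digraph \<Rightarrow> bool" where
  "bipartite G \<longleftrightarrow> (\<exists>X Y. X \<union> Y = pverts G \<and> X \<inter> Y = {} \<and>
     (\<forall>(u, v) \<in> parcs G. (u \<in> X \<and> v \<in> Y) \<or> (u \<in> Y \<and> v \<in> X)))"

definition vertex_cover :: "'a pair_pre_digraph \<Rightarrow> 'a set \<Rightarrow> bool" where
  "vertex_cover G C \<longleftrightarrow> C \<subseteq> pverts G \<and> (\<forall>(u, v) \<in> parcs G. u \<in> C \<or> v \<in> C)"

(* The list vs enumerates the vertices, with indices starting at 0. *)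

definition adjacency_matrix :: "'a pair_pre_digraph \<Rightarrow> 'a list \<Rightarrow> complex mat" where
  "adjacency_matrix G vs =
     mat (length vs) (length vs) (\<lambda>(i, j). if (vs ! i, vs ! j) \<in> parcs G then 1 else 0)"

definition hermitian_mat :: "complex mat \<Rightarrow> bool" where
  "hermitian_mat M \<longleftrightarrow> square_mat M \<and> mat_adjoint M = M"

(* For Hermitian M the value of the quadratic form is real, so taking Re loses nothing. *)

definition psd_mat :: "complex mat \<Rightarrow> bool" where
  "psd_mat M \<longleftrightarrow> hermitian_mat M \<and>
     (\<forall>x \<in> carrier_vec (dim_row M). Re ((M *\<^sub>v x) \<bullet>c x) \<ge> 0)"

(* Every positive semidefinite M has a unique positive semidefinite square root;
   for other M the value is unspecified. *)

definition psd_sqrt :: "complex mat \<Rightarrow> complex mat" where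
  "psd_sqrt M = (THE B. B \<in> carrier_mat (dim_row M) (dim_row M) \<and> psd_mat B \<and> B * B = M)"

definition mat_abs :: "complex mat \<Rightarrow> complex mat" where
  "mat_abs M = psd_sqrt (M * mat_adjoint M)"

(* The energy of the vertex vs ! i. The diagonal entries of the Hermitian matrix |A| are real,
   so Re only changes the type. *)

definition vertex_energy :: "'a pair_pre_digraph \<Rightarrow> 'a list \<Rightarrow> nat \<Rightarrow> real" where
  "vertex_energy G vs i = Re (mat_abs (adjacency_matrix G vs) $$ (i, i))"

(* "proots" is the multiset of roots, so eigenvalues are counted with algebraic multiplicity. *)

definition graph_energy :: "'a pair_pre_digraph \<Rightarrow> 'a list \<Rightarrow> real" where
  "graph_energy G vs = (\<Sum>z\<in>#proots (char_poly (adjacency_matrix G vs)). cmod z)"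

end

theory Submission
  imports Defs
begin

text \<open>
  The claim amounts to this: the cover \<open>C\<close> carries at least as much vertex energy as its
  complement. For the vertex energies sum to \<open>tr |A|\<close>, which is the graph energy (lemma \<open>sum_mat_abs_diagonal\<close>). The
  complement of a vertex cover is independent, so the adjacency matrix \<open>A\<close> has a zero block there.

  Let \<open>J\<close> be the diagonal matrix whose entries \<open>\<epsilon> i\<close> are \<open>1\<close> on \<open>C\<close> and \<open>- 1\<close> off \<open>C\<close>; the energy
  surplus of \<open>C\<close> over its complement is \<open>tr (J |A|)\<close>. Let \<open>W\<close> be the sign of \<open>A\<close>,
  so that \<open>|A| = W A = A W\<close>. The zero block means
  \<open>J A + A J = A + J A J\<close>: entrywise this compares \<open>\<epsilon> i + \<epsilon> j\<close> with \<open>1 + \<epsilon> i \<epsilon> j\<close>, which differ only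
  when both signs are negative. Multiplying by \<open>W\<close> and taking traces,
  \<open>2 tr (J |A|) = tr |A| + tr (J W J A)\<close>.
  Since \<open>J W J\<close> is a contraction, the last trace is at least \<open>- tr |A|\<close>
  (lemma \<open>mat_trace_signed_product_ge\<close>), so the surplus is nonnegative
  (lemma \<open>signed_abs_diagonal_nonneg\<close>).

  Two facts of linear algebra support this. The spectral theorem for Hermitian matrices
  (\<open>hermitian_spectral_decomposition\<close>) makes \<open>A\<close>, \<open>W\<close> and the candidate for \<open>|A|\<close> simultaneously
  diagonal. Uniqueness of positive semidefinite square roots (\<open>psd_square_inj\<close>) identifies that
  candidate with \<open>mat_abs A\<close>, which is specified by a definite description.
\<close>

section \<open>Adjoint and trace\<close>

lemma mat_adjoint_conv:
  "mat_adjoint A = mat (dim_col A) (dim_row A) (\<lambda>(i, j). conjugate (A $$ (j, i)))"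
  by (rule eq_matI) (auto simp: mat_adjoint_def mat_of_rows_index)

lemma mat_adjoint_index [simp]:
  "i < dim_col A \<Longrightarrow> j < dim_row A \<Longrightarrow> mat_adjoint A $$ (i, j) = conjugate (A $$ (j, i))"
  by (simp add: mat_adjoint_conv)

lemma mat_adjoint_dims [simp]:
  "dim_row (mat_adjoint A) = dim_col A" "dim_col (mat_adjoint A) = dim_row A"
  by (simp_all add: mat_adjoint_conv)

lemma mat_adjoint_carrier [simp, intro]:
  "A \<in> carrier_mat n m \<Longrightarrow> mat_adjoint A \<in> carrier_mat m n"
  by (intro carrier_matI) auto

lemma mat_adjoint_adjoint [simp]: "mat_adjoint (mat_adjoint A) = A"
  by (rule eq_matI) auto

lemma index_mult_mat_sum:
  assumes "A \<in> carrier_mat n m" "B \<in> carrier_mat m k" "i < n" "j < k"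
  shows "(A * B) $$ (i, j) = (\<Sum>l<m. A $$ (i, l) * B $$ (l, j))"
  using assms by (auto simp: scalar_prod_def lessThan_atLeast0 intro!: sum.cong)

lemma mat_adjoint_mult:
  fixes A B :: "'a :: conjugatable_field mat"
  assumes A: "A \<in> carrier_mat n m" and B: "B \<in> carrier_mat m k"
  shows "mat_adjoint (A * B) = mat_adjoint B * mat_adjoint A"
proof (rule eq_matI)
  fix i j assume "i < dim_row (mat_adjoint B * mat_adjoint A)"
    and "j < dim_col (mat_adjoint B * mat_adjoint A)"
  then have ij: "i < k" "j < n" using A B by auto
  have "mat_adjoint (A * B) $$ (i, j) = conjugate ((A * B) $$ (j, i))"
    using A B ij by simp
  also have "\<dots> = (\<Sum>l<m. conjugate (A $$ (j, l) * B $$ (l, i)))"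
    using index_mult_mat_sum[OF A B ij(2,1)] by (simp add: sum_conjugate)
  also have "\<dots> = (mat_adjoint B * mat_adjoint A) $$ (i, j)"
    using A B ij index_mult_mat_sum[OF mat_adjoint_carrier[OF B] mat_adjoint_carrier[OF A] ij]
    by (simp add: conjugate_dist_mul mult.commute)
  finally show "mat_adjoint (A * B) $$ (i, j) = (mat_adjoint B * mat_adjoint A) $$ (i, j)" .
qed (use A B in auto)

definition mat_trace :: "'a :: comm_monoid_add mat \<Rightarrow> 'a" where
  "mat_trace A = (\<Sum>i<dim_row A. A $$ (i, i))"

lemma mat_trace_comm:
  fixes A B :: "'a :: comm_semiring_0 mat"
  assumes A: "A \<in> carrier_mat n m" and B: "B \<in> carrier_mat m n"
  shows "mat_trace (A * B) = mat_trace (B * A)"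
proof -
  have "mat_trace (A * B) = (\<Sum>i<n. \<Sum>l<m. A $$ (i, l) * B $$ (l, i))"
    unfolding mat_trace_def using A by (auto simp: index_mult_mat_sum[OF A B] intro!: sum.cong)
  also have "\<dots> = (\<Sum>l<m. \<Sum>i<n. B $$ (l, i) * A $$ (i, l))"
    by (subst sum.swap) (simp add: mult.commute)
  also have "\<dots> = mat_trace (B * A)"
    unfolding mat_trace_def using B by (auto simp: index_mult_mat_sum[OF B A] intro!: sum.cong)
  finally show ?thesis .
qed

text \<open>The trace equals the trace of a Schur triangular form, whose diagonal lists the eigenvalues.
  Read contrapositively, a matrix whose trace is not \<open>n c\<close> has an eigenvalue other than \<open>c\<close>;
  the spectral theorem below finds its eigenvectors in this way.\<close>
lemma unique_eigenvalue_trace: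
  fixes M :: "complex mat"
  assumes M: "M \<in> carrier_mat n n"
    and only: "\<And>e. eigenvalue M e \<Longrightarrow> e = c"
  shows "mat_trace M = of_nat n * c"
proof -
  obtain es where es: "char_poly M = (\<Prod>a\<leftarrow>es. [:- a, 1:])"
    using char_poly_factorized[OF M] by blast
  obtain B P Q where "schur_decomposition M es = (B, P, Q)"
    by (cases "schur_decomposition M es")
  from schur_decomposition[OF M es this]
  have sim: "similar_mat_wit M B P Q" and diag: "diag_mat B = es" by auto
  note wit = similar_mat_witD2[OF M sim]
  have "a = c" if "a \<in> set es" for a
  proof (rule only)
    have "poly (char_poly M) a = (\<Prod>x\<leftarrow>es. a - x)"
      unfolding es poly_prod_list by (simp add: o_def)
    then have "poly (char_poly M) a = 0"
      using that by (auto simp: prod_list_zero_iff)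
    then show "eigenvalue M a" using eigenvalue_root_char_poly[OF M] by simp
  qed
  then have "\<And>i. i < n \<Longrightarrow> B $$ (i, i) = c"
    using diag wit by (force simp: diag_mat_def)
  then have "mat_trace B = of_nat n * c"
    using wit unfolding mat_trace_def by auto
  moreover have "mat_trace M = mat_trace (Q * (P * B))"
    using wit mat_trace_comm[of "P * B" n n Q] by auto
  moreover have "Q * (P * B) = B"
    using wit by (metis assoc_mult_mat left_mult_one_mat)
  ultimately show ?thesis by simp
qed

section \<open>The spectral theorem for Hermitian matrices\<close>

text \<open>The step from \<open>k\<close> to \<open>k + 1\<close> orthonormal eigenvectors is by deflation. The matrix
  \<open>M = A + \<Sum>i<k. (c - d i) u_i u_i*\<close> has every \<open>u_i\<close> as an eigenvector with eigenvalue \<open>c\<close>. Being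
  Hermitian, \<open>M\<close> has all eigenvectors for other eigenvalues orthogonal to the \<open>u_i\<close>, and on vectors
  orthogonal to the \<open>u_i\<close> it agrees with \<open>A\<close>. So one eigenvalue of \<open>M\<close> other than \<open>c\<close> suffices,
  and the trace supplies it for a suitable \<open>c\<close>. This keeps all matrices at size \<open>n\<close>, with no
  restriction to an orthogonal complement. Vectors are index functions, so that the family can
  grow with \<open>k\<close> by function update.\<close>
lemma hermitian_extend_orthonormal_eigenvectors:
  fixes A :: "complex mat" and u :: "nat \<Rightarrow> nat \<Rightarrow> complex" and d :: "nat \<Rightarrow> real"
  assumes A: "A \<in> carrier_mat n n" and herm: "mat_adjoint A = A" and kn: "k < n"
    and ortho: "\<And>i j. i < k \<Longrightarrow> j < k \<Longrightarrow> (\<Sum>a<n. cnj (u i a) * u j a) = (if i = j then 1 else 0)"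
    and eig: "\<And>j a. j < k \<Longrightarrow> a < n \<Longrightarrow> (\<Sum>b<n. A $$ (a, b) * u j b) = of_real (d j) * u j a"
  obtains w :: "nat \<Rightarrow> complex" and e :: real where
    "\<And>j. j < k \<Longrightarrow> (\<Sum>a<n. cnj (u j a) * w a) = 0" "(\<Sum>a<n. cnj (w a) * w a) = 1"
    "\<And>a. a < n \<Longrightarrow> (\<Sum>b<n. A $$ (a, b) * w b) = of_real e * w a"
proof -
  have hA: "cnj (A $$ (a, b)) = A $$ (b, a)" if "a < n" "b < n" for a b
    using that A mat_adjoint_index[of b A a] unfolding herm by simp
  \<comment> \<open>The quotient is the only \<open>c\<close> at which the real part of the trace of \<open>M\<close> equals \<open>n c\<close>;
    adding 1 avoids it.\<close>
  define c where "c = (Re (mat_trace A) - (\<Sum>i<k. d i)) / (real n - real k) + 1"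
  define M where "M = mat n n (\<lambda>(a, b). A $$ (a, b) +
    (\<Sum>i<k. of_real (c - d i) * u i a * cnj (u i b)))"
  have M: "M \<in> carrier_mat n n" by (simp add: M_def)
  have "mat_trace M = mat_trace A + (\<Sum>a<n. \<Sum>i<k. of_real (c - d i) * (cnj (u i a) * u i a))"
    using A by (simp add: mat_trace_def M_def sum.distrib mult_ac)
  also have "(\<Sum>a<n. \<Sum>i<k. of_real (c - d i) * (cnj (u i a) * u i a)) =
      (\<Sum>i<k. of_real (c - d i) * (\<Sum>a<n. cnj (u i a) * u i a))"
    by (subst sum.swap) (simp add: sum_distrib_left)
  also have "\<dots> = of_real (\<Sum>i<k. c - d i)"
    using ortho by simp
  finally have trM: "Re (mat_trace M) = Re (mat_trace A) + (real k * c - (\<Sum>i<k. d i))"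
    by (simp add: sum_subtractf)
  have "mat_trace M \<noteq> of_nat n * of_real c"
  proof
    assume "mat_trace M = of_nat n * of_real c"
    then have "Re (mat_trace M) = real n * c" by simp
    with trM have "Re (mat_trace A) - (\<Sum>i<k. d i) = (real n - real k) * c"
      by (simp add: algebra_simps)
    moreover have "(real n - real k) * c =
        Re (mat_trace A) - (\<Sum>i<k. d i) + (real n - real k)"
      using kn unfolding c_def by (simp add: field_simps)
    ultimately show False using kn by simp
  qed
  with unique_eigenvalue_trace[OF M, of "of_real c"] obtain e where
    "eigenvalue M e" and ec: "e \<noteq> of_real c" by blast
  then obtain x where "eigenvector M x e" by (auto simp: eigenvalue_def)
  then have x: "x \<in> carrier_vec n" "x \<noteq> 0\<^sub>v n" and Mx: "M *\<^sub>v x = e \<cdot>\<^sub>v x"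
    using M by (auto simp: eigenvector_def)
  define v where "v a = x $ a" for a
  define p where "p j = (\<Sum>a<n. cnj (u j a) * v a)" for j
  have Mv: "(\<Sum>b<n. A $$ (a, b) * v b) + (\<Sum>i<k. of_real (c - d i) * u i a * p i) = e * v a"
    if a: "a < n" for a
  proof -
    have "e * v a = (M *\<^sub>v x) $ a" using a x unfolding Mx v_def by simp
    also have "\<dots> = (\<Sum>b<n. M $$ (a, b) * v b)"
      using a x M by (auto simp: scalar_prod_def lessThan_atLeast0 v_def intro!: sum.cong)
    also have "\<dots> = (\<Sum>b<n. A $$ (a, b) * v b) +
        (\<Sum>b<n. \<Sum>i<k. of_real (c - d i) * u i a * (cnj (u i b) * v b))"
      using a by (simp add: M_def distrib_right sum.distrib sum_distrib_right mult.assoc)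
    also have "(\<Sum>b<n. \<Sum>i<k. of_real (c - d i) * u i a * (cnj (u i b) * v b)) =
        (\<Sum>i<k. of_real (c - d i) * u i a * p i)"
      by (subst sum.swap) (simp add: p_def sum_distrib_left)
    finally show ?thesis by simp
  qed
  \<comment> \<open>Pairing the eigenvector equation with \<open>u j\<close> gives \<open>c p_j = e p_j\<close>.\<close>
  have p0: "p j = 0" if j: "j < k" for j
  proof -
    have 1: "(\<Sum>a<n. cnj (u j a) * (\<Sum>b<n. A $$ (a, b) * v b)) = of_real (d j) * p j"
    proof -
      have "(\<Sum>a<n. cnj (u j a) * (\<Sum>b<n. A $$ (a, b) * v b)) =
          (\<Sum>b<n. (\<Sum>a<n. A $$ (a, b) * cnj (u j a)) * v b)"
        unfolding sum_distrib_left sum_distrib_right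
        by (subst sum.swap) (simp add: mult_ac)
      also have "\<dots> = (\<Sum>b<n. of_real (d j) * cnj (u j b) * v b)"
      proof (rule sum.cong[OF refl])
        fix b assume "b \<in> {..<n}"
        then have b: "b < n" by simp
        have "(\<Sum>a<n. A $$ (a, b) * cnj (u j a)) = cnj (\<Sum>a<n. A $$ (b, a) * u j a)"
          using b by (simp add: hA)
        also have "\<dots> = of_real (d j) * cnj (u j b)"
          unfolding eig[OF j b] by simp
        finally show "(\<Sum>a<n. A $$ (a, b) * cnj (u j a)) * v b =
          of_real (d j) * cnj (u j b) * v b" by simp
      qed
      finally show ?thesis by (simp add: p_def sum_distrib_left mult.assoc)
    qed
    have 2: "(\<Sum>a<n. cnj (u j a) * (\<Sum>i<k. of_real (c - d i) * u i a * p i)) =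
        of_real (c - d j) * p j"
    proof -
      have "(\<Sum>a<n. cnj (u j a) * (\<Sum>i<k. of_real (c - d i) * u i a * p i)) =
          (\<Sum>i<k. of_real (c - d i) * p i * (\<Sum>a<n. cnj (u j a) * u i a))"
        unfolding sum_distrib_left by (subst sum.swap) (simp add: mult_ac)
      also have "\<dots> = (\<Sum>i<k. if i = j then of_real (c - d i) * p i else 0)"
        using j by (intro sum.cong) (auto simp: ortho)
      finally show ?thesis using j by simp
    qed
    have "e * p j = (\<Sum>a<n. cnj (u j a) * (e * v a))"
      by (simp add: p_def sum_distrib_left mult_ac)
    also have "\<dots> = (\<Sum>a<n. cnj (u j a) * (\<Sum>b<n. A $$ (a, b) * v b) +
        cnj (u j a) * (\<Sum>i<k. of_real (c - d i) * u i a * p i))"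
      by (intro sum.cong) (simp_all add: Mv[symmetric] distrib_left)
    also have "\<dots> = of_real c * p j"
      unfolding sum.distrib 1 2 by (simp add: algebra_simps)
    finally show ?thesis using ec by simp
  qed
  have Av: "(\<Sum>b<n. A $$ (a, b) * v b) = e * v a" if "a < n" for a
    using Mv[OF that] p0 by simp
  define r where "r = (\<Sum>a<n. (cmod (v a))\<^sup>2)"
  have r: "(\<Sum>a<n. cnj (v a) * v a) = of_real r"
    by (simp add: r_def complex_norm_square mult.commute del: of_real_power)
  have "\<exists>a<n. v a \<noteq> 0"
    using x by (metis eq_vecI carrier_vecD index_zero_vec v_def)
  then have "r > 0"
    unfolding r_def by (auto intro!: sum_pos2)
  have quad: "(\<Sum>a<n. cnj (v a) * (\<Sum>b<n. A $$ (a, b) * v b)) = e * of_real r"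
  proof -
    have "(\<Sum>a<n. cnj (v a) * (\<Sum>b<n. A $$ (a, b) * v b)) = (\<Sum>a<n. e * (cnj (v a) * v a))"
      by (intro sum.cong) (simp_all add: Av)
    then show ?thesis by (simp add: r flip: sum_distrib_left)
  qed
  \<comment> \<open>The quadratic form of a Hermitian matrix is real, hence so is the eigenvalue \<open>e\<close>.\<close>
  have "cnj (e * of_real r) = cnj (\<Sum>a<n. cnj (v a) * (\<Sum>b<n. A $$ (a, b) * v b))"
    by (simp only: quad)
  also have "\<dots> = (\<Sum>a<n. \<Sum>b<n. v a * (A $$ (b, a) * cnj (v b)))"
    by (simp add: sum_distrib_left hA)
  also have "\<dots> = (\<Sum>b<n. cnj (v b) * (\<Sum>a<n. A $$ (b, a) * v a))"
    by (subst sum.swap) (simp add: sum_distrib_left mult_ac)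
  also have "\<dots> = e * of_real r"
    by (fact quad)
  finally have "cnj e = e" using \<open>r > 0\<close> by simp
  then have e: "e = of_real (Re e)" by (metis Reals_cnj_iff of_real_Re)
  define w where "w a = v a / of_real (sqrt r)" for a
  show thesis
  proof
    show "(\<Sum>a<n. cnj (u j a) * w a) = 0" if "j < k" for j
      using p0[OF that] unfolding p_def w_def by (simp flip: sum_divide_distrib)
    have "(\<Sum>a<n. cnj (w a) * w a) = (\<Sum>a<n. cnj (v a) * v a) / of_real (sqrt r * sqrt r)"
      by (simp add: w_def sum_divide_distrib del: real_sqrt_mult_self flip: of_real_mult)
    also have "\<dots> = of_real r / of_real (sqrt r * sqrt r)"
      by (simp only: r)
    finally show "(\<Sum>a<n. cnj (w a) * w a) = 1" using \<open>r > 0\<close> by simp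
    show "(\<Sum>b<n. A $$ (a, b) * w b) = of_real (Re e) * w a" if "a < n" for a
      using Av[OF that] e unfolding w_def by (simp flip: sum_divide_distrib)
  qed
qed

lemma hermitian_orthonormal_eigenvectors:
  fixes A :: "complex mat"
  assumes A: "A \<in> carrier_mat n n" and herm: "mat_adjoint A = A" and "k \<le> n"
  shows "\<exists>(u :: nat \<Rightarrow> nat \<Rightarrow> complex) (d :: nat \<Rightarrow> real).
    (\<forall>i<k. \<forall>j<k. (\<Sum>a<n. cnj (u i a) * u j a) = (if i = j then 1 else 0)) \<and>
    (\<forall>j<k. \<forall>a<n. (\<Sum>b<n. A $$ (a, b) * u j b) = of_real (d j) * u j a)"
  using \<open>k \<le> n\<close>
proof (induction k)
  case (Suc k)
  then have "k \<le> n" by simp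
  from Suc.IH[OF this] obtain u :: "nat \<Rightarrow> nat \<Rightarrow> complex" and d :: "nat \<Rightarrow> real" where
    ortho: "\<And>i j. i < k \<Longrightarrow> j < k \<Longrightarrow> (\<Sum>a<n. cnj (u i a) * u j a) = (if i = j then 1 else 0)"
    and eig: "\<And>j a. j < k \<Longrightarrow> a < n \<Longrightarrow> (\<Sum>b<n. A $$ (a, b) * u j b) = of_real (d j) * u j a"
    by blast
  from Suc.prems have "k < n" by simp
  from hermitian_extend_orthonormal_eigenvectors[OF A herm this ortho eig]
  obtain w :: "nat \<Rightarrow> complex" and e :: real where
    w: "\<And>j. j < k \<Longrightarrow> (\<Sum>a<n. cnj (u j a) * w a) = 0" "(\<Sum>a<n. cnj (w a) * w a) = 1"
      "\<And>a. a < n \<Longrightarrow> (\<Sum>b<n. A $$ (a, b) * w b) = of_real e * w a"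
    by blast
  have w': "(\<Sum>a<n. cnj (w a) * u j a) = 0" if "j < k" for j
    using arg_cong[OF w(1)[OF that], of cnj] by (simp add: mult.commute)
  show ?case
    by (rule exI[of _ "u(k := w)"], rule exI[of _ "d(k := e)"])
      (auto simp: less_Suc_eq ortho eig w w')
qed simp

definition unitary_mat :: "nat \<Rightarrow> complex mat \<Rightarrow> bool" where
  "unitary_mat n U \<longleftrightarrow> U \<in> carrier_mat n n \<and> mat_adjoint U * U = 1\<^sub>m n \<and> U * mat_adjoint U = 1\<^sub>m n"

text \<open>With the columns of a unitary \<open>U\<close> as an orthonormal eigenbasis, \<open>diag_conj n U f\<close> is the normal
  matrix with eigenvalues \<open>f 0, \<dots>, f (n - 1)\<close>. Keeping \<open>U\<close> fixed and varying \<open>f\<close> is functional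
  calculus: from \<open>f\<close> the eigenvalues of \<open>A\<close>, one reaches \<open>|A|\<close> and the sign of \<open>A\<close>.\<close>
definition diag_conj :: "nat \<Rightarrow> complex mat \<Rightarrow> (nat \<Rightarrow> complex) \<Rightarrow> complex mat" where
  "diag_conj n U f = U * mat_diag n f * mat_adjoint U"

theorem hermitian_spectral_decomposition:
  fixes A :: "complex mat"
  assumes A: "A \<in> carrier_mat n n" and herm: "mat_adjoint A = A"
  obtains U :: "complex mat" and d :: "nat \<Rightarrow> real" where
    "unitary_mat n U" "A = diag_conj n U (\<lambda>i. of_real (d i))"
proof -
  obtain u :: "nat \<Rightarrow> nat \<Rightarrow> complex" and d :: "nat \<Rightarrow> real" where
    ortho: "\<And>i j. i < n \<Longrightarrow> j < n \<Longrightarrow> (\<Sum>a<n. cnj (u i a) * u j a) = (if i = j then 1 else 0)"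
    and eig: "\<And>j a. j < n \<Longrightarrow> a < n \<Longrightarrow> (\<Sum>b<n. A $$ (a, b) * u j b) = of_real (d j) * u j a"
    using hermitian_orthonormal_eigenvectors[OF A herm order_refl] by blast
  define U where "U = mat n n (\<lambda>(a, j). u j a)"
  have U: "U \<in> carrier_mat n n" by (simp add: U_def)
  note U' = mat_adjoint_carrier[OF U]
  have UU: "mat_adjoint U * U = 1\<^sub>m n"
  proof (rule eq_matI)
    fix i j assume "i < dim_row (1\<^sub>m n :: complex mat)" "j < dim_col (1\<^sub>m n :: complex mat)"
    then show "(mat_adjoint U * U) $$ (i, j) = 1\<^sub>m n $$ (i, j)"
      using index_mult_mat_sum[OF U' U, of i j] ortho[of i j] U by (simp add: U_def)
  qed (use U in auto)
  have UU': "U * mat_adjoint U = 1\<^sub>m n"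
    using mat_mult_left_right_inverse[OF U' U UU] .
  have AU: "A * U = U * mat_diag n (\<lambda>i. of_real (d i))"
  proof (subst mat_diag_mult_right[OF U], rule eq_matI)
    fix a j assume "a < dim_row (mat n n (\<lambda>(i, j). U $$ (i, j) * complex_of_real (d j)))"
      "j < dim_col (mat n n (\<lambda>(i, j). U $$ (i, j) * complex_of_real (d j)))"
    then show "(A * U) $$ (a, j) = mat n n (\<lambda>(i, j). U $$ (i, j) * complex_of_real (d j)) $$ (a, j)"
      using index_mult_mat_sum[OF A U, of a j] eig[of j a] by (simp add: U_def)
  qed (use A U in auto)
  have "A = A * (U * mat_adjoint U)" using A UU' by simp
  also have "\<dots> = U * mat_diag n (\<lambda>i. of_real (d i)) * mat_adjoint U"
    using A U AU by (metis U' assoc_mult_mat)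
  finally have "A = diag_conj n U (\<lambda>i. of_real (d i))" by (simp only: diag_conj_def)
  moreover have "unitary_mat n U" using U UU UU' by (simp only: unitary_mat_def simp_thms)
  ultimately show thesis by (intro that)
qed

section \<open>Functional calculus in a fixed eigenbasis\<close>

text \<open>Without fixed dimensions the simplifier would have to guess the inner ones when it discharges
  the carrier conditions.\<close>
lemmas assoc_mult_carrier_square_matuare_mat = assoc_mult_mat[of _ n n _ n _ n] for n
lemmas mult_carrier_square_mat = mult_carrier_mat[of _ n n _ n] for n

lemma unitary_matD:
  assumes "unitary_mat n U"
  shows "U \<in> carrier_mat n n" "mat_adjoint U \<in> carrier_mat n n"
    "mat_adjoint U * U = 1\<^sub>m n" "U * mat_adjoint U = 1\<^sub>m n"
  using assms by (auto simp: unitary_mat_def)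

lemma unitary_cancel:
  assumes "unitary_mat n U" "Z \<in> carrier_mat n m"
  shows "mat_adjoint U * (U * Z) = Z" "U * (mat_adjoint U * Z) = Z"
proof -
  note c = unitary_matD[OF assms(1)]
  show "mat_adjoint U * (U * Z) = Z"
    using assoc_mult_mat[OF c(2,1) assms(2)] c(3) assms(2) by simp
  show "U * (mat_adjoint U * Z) = Z"
    using assoc_mult_mat[OF c(1,2) assms(2)] c(4) assms(2) by simp
qed

lemma diag_conj_carrier [simp]:
  "unitary_mat n U \<Longrightarrow> diag_conj n U f \<in> carrier_mat n n"
  unfolding diag_conj_def by (meson mat_diag_dim mult_carrier_mat unitary_matD)

lemma diag_conj_mult:
  assumes U: "unitary_mat n U"
  shows "diag_conj n U f * diag_conj n U g = diag_conj n U (\<lambda>i. f i * g i)"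
proof -
  note c = unitary_matD(1,2)[OF U]
  have "diag_conj n U f * diag_conj n U g =
      U * (mat_diag n f * (mat_adjoint U * (U * (mat_diag n g * mat_adjoint U))))"
    unfolding diag_conj_def using c by (simp add: assoc_mult_carrier_square_matuare_mat[where n = n] mult_carrier_square_mat[where n = n])
  also have "\<dots> = U * (mat_diag n f * (mat_diag n g * mat_adjoint U))"
    using c by (subst unitary_cancel(1)[OF U, where m = n]) (auto simp: mult_carrier_square_mat[where n = n])
  also have "\<dots> = U * ((mat_diag n f * mat_diag n g) * mat_adjoint U)"
    using c by (subst assoc_mult_carrier_square_matuare_mat[where n = n]) auto
  also have "\<dots> = diag_conj n U (\<lambda>i. f i * g i)"
    unfolding diag_conj_def using c by (subst assoc_mult_carrier_square_matuare_mat[where n = n]) auto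
  finally show ?thesis .
qed

lemma mat_adjoint_diag:
  "mat_adjoint (mat_diag n f) = mat_diag n (\<lambda>i. conjugate (f i))"
  by (rule eq_matI) (auto simp: mat_diag_def)

lemma mat_adjoint_diag_conj:
  assumes U: "unitary_mat n U"
  shows "mat_adjoint (diag_conj n U f) = diag_conj n U (\<lambda>i. cnj (f i))"
  using unitary_matD(1,2)[OF U] unfolding diag_conj_def
  by (simp add: mat_adjoint_mult[of _ n n _ n] mult_carrier_square_mat[where n = n] assoc_mult_carrier_square_matuare_mat[where n = n] mat_adjoint_diag)

lemma mat_trace_diag_conj:
  assumes U: "unitary_mat n U"
  shows "mat_trace (diag_conj n U f) = (\<Sum>i<n. f i)"
proof -
  note c = unitary_matD[OF U]
  have "mat_trace (diag_conj n U f) = mat_trace (mat_adjoint U * (U * mat_diag n f))"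
    unfolding diag_conj_def using c by (intro mat_trace_comm[of _ n n]) (auto simp: mult_carrier_square_mat[where n = n])
  also have "mat_adjoint U * (U * mat_diag n f) = mat_diag n f"
    by (rule unitary_cancel(1)[OF U, where m = n]) simp
  finally show ?thesis by (simp add: mat_trace_def mat_diag_def)
qed

lemma proots_char_poly_diag_conj:
  assumes U: "unitary_mat n U"
  shows "proots (char_poly (diag_conj n U f)) = mset (map f [0..<n])"
proof -
  note c = unitary_matD[OF U]
  have "similar_mat (diag_conj n U f) (mat_diag n f)"
    unfolding similar_mat_def similar_mat_wit_def Let_def
    using c U by (intro exI[of _ U] exI[of _ "mat_adjoint U"]) (auto simp: diag_conj_def)
  then have "char_poly (diag_conj n U f) = char_poly (mat_diag n f)"
    by (rule char_poly_similar)
  also have "\<dots> = (\<Prod>a\<leftarrow>diag_mat (mat_diag n f). [:- a, 1:])"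
    by (rule char_poly_upper_triangular[of _ n]) (auto simp: mat_diag_def)
  also have "diag_mat (mat_diag n f) = map f [0..<n]"
    by (auto simp: diag_mat_def mat_diag_def)
  finally have "char_poly (diag_conj n U f) = (\<Prod>a\<leftarrow>map f [0..<n]. [:- a, 1:])" .
  moreover have "proots (\<Prod>a\<leftarrow>xs. [:- a, 1:]) = mset xs" for xs :: "complex list"
  proof (induction xs)
    case (Cons a xs)
    have "(\<Prod>a\<leftarrow>xs. [:- a, 1:]) \<noteq> 0" by (auto simp: prod_list_zero_iff)
    then have "proots ([:- a, 1:] * (\<Prod>a\<leftarrow>xs. [:- a, 1:])) = {#a#} + mset xs"
      by (subst proots_mult) (use Cons in auto)
    then show ?case by simp
  qed simp
  ultimately show ?thesis by (simp only:)
qed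

lemma cscalar_prod_adjoint:
  fixes A :: "complex mat"
  assumes A: "A \<in> carrier_mat n m" and x: "x \<in> carrier_vec m" and y: "y \<in> carrier_vec n"
  shows "(A *\<^sub>v x) \<bullet>c y = x \<bullet>c (mat_adjoint A *\<^sub>v y)"
proof -
  have "(A *\<^sub>v x) \<bullet>c y = (\<Sum>i<n. \<Sum>l<m. A $$ (i, l) * x $ l * cnj (y $ i))"
    using A x y by (auto simp: scalar_prod_def lessThan_atLeast0 sum_distrib_right intro!: sum.cong)
  also have "\<dots> = (\<Sum>l<m. \<Sum>i<n. x $ l * (A $$ (i, l) * cnj (y $ i)))"
    by (subst sum.swap) (simp add: mult_ac)
  also have "\<dots> = x \<bullet>c (mat_adjoint A *\<^sub>v y)"
    using A x y by (auto simp: scalar_prod_def lessThan_atLeast0 sum_distrib_left intro!: sum.cong)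
  finally show ?thesis .
qed

text \<open>In the eigenbasis coordinates \<open>y = U* x\<close> the quadratic form is \<open>\<Sum>i. f i |y_i|^2\<close>.\<close>
lemma psd_diag_conj:
  assumes U: "unitary_mat n U" and f: "\<And>i. i < n \<Longrightarrow> f i \<ge> 0"
  shows "psd_mat (diag_conj n U (\<lambda>i. of_real (f i)))"
proof -
  note c = unitary_matD[OF U]
  let ?D = "mat_diag n (\<lambda>i. complex_of_real (f i))"
  have "Re ((diag_conj n U (\<lambda>i. of_real (f i)) *\<^sub>v x) \<bullet>c x) \<ge> 0" if x: "x \<in> carrier_vec n" for x
  proof -
    define y where "y = mat_adjoint U *\<^sub>v x"
    have y: "y \<in> carrier_vec n" using mult_mat_vec_carrier[OF c(2) x] by (simp add: y_def)
    have "diag_conj n U (\<lambda>i. of_real (f i)) *\<^sub>v x = U *\<^sub>v (?D *\<^sub>v y)"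
      unfolding diag_conj_def y_def using c x y[unfolded y_def]
      by (simp add: assoc_mult_mat_vec[of _ n n _ n] mult_carrier_square_mat[where n = n])
    then have "(diag_conj n U (\<lambda>i. of_real (f i)) *\<^sub>v x) \<bullet>c x = (?D *\<^sub>v y) \<bullet>c y"
      using cscalar_prod_adjoint[OF c(1) mult_mat_vec_carrier[OF mat_diag_dim y] x]
      by (simp add: y_def)
    also have "\<dots> = (\<Sum>i<n. of_real (f i) * y $ i * cnj (y $ i))"
    proof -
      have "(?D *\<^sub>v y) $ i = of_real (f i) * y $ i" if "i < n" for i
      proof -
        have "(?D *\<^sub>v y) $ i = (\<Sum>j<n. (if i = j then of_real (f j) else 0) * y $ j)"
          using that y by (auto simp: scalar_prod_def mat_diag_def lessThan_atLeast0 intro!: sum.cong)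
        also have "\<dots> = (\<Sum>j<n. if i = j then of_real (f j) * y $ j else 0)"
          by (intro sum.cong) auto
        finally show ?thesis using that by simp
      qed
      then show ?thesis
        using y by (simp add: scalar_prod_def lessThan_atLeast0)
    qed
    also have "\<dots> = of_real (\<Sum>i<n. f i * (cmod (y $ i))\<^sup>2)"
      by (simp add: complex_norm_square mult.assoc del: of_real_power)
    finally show ?thesis using f by (auto intro!: sum_nonneg)
  qed
  then show ?thesis
    using carrier_matD[OF diag_conj_carrier[OF U, of "\<lambda>i. of_real (f i)"]] unfolding psd_mat_def hermitian_mat_def
    by (auto simp: mat_adjoint_diag_conj[OF U])
qed

section \<open>Uniqueness of the positive semidefinite square root\<close>

text \<open>The diagonal entries of \<open>U* B U\<close> are the values of the quadratic form of \<open>B\<close> at the columns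
  of \<open>U\<close>.\<close>
lemma psd_congruence_diagonal:
  assumes psd: "psd_mat B" and B: "B \<in> carrier_mat n n" and U: "U \<in> carrier_mat n m" and k: "k < m"
  shows "Re ((mat_adjoint U * (B * U)) $$ (k, k)) \<ge> 0"
proof -
  have cU: "col U k \<in> carrier_vec n" using U by auto
  have "(mat_adjoint U * (B * U)) $$ (k, k) = row (mat_adjoint U) k \<bullet> (B *\<^sub>v col U k)"
    using B U k by (simp add: col_mult2[OF B U k])
  also have "row (mat_adjoint U) k = conjugate (col U k)"
    using U k by (intro eq_vecI) auto
  also have "conjugate (col U k) \<bullet> (B *\<^sub>v col U k) = (B *\<^sub>v col U k) \<bullet>c col U k"
    using B cU by (intro comm_scalar_prod[of _ n]) auto
  finally show ?thesis using psd cU B unfolding psd_mat_def by auto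
qed

text \<open>Uniqueness of the positive semidefinite square root. The Hermitian difference \<open>X = B - B'\<close>
  satisfies \<open>B X + X B' = B^2 - B'^2 = 0\<close>. At a unit eigenvector \<open>u\<close> of \<open>X\<close> with eigenvalue \<open>d\<close>
  this reads \<open>d (<B u, u> + <B' u, u>) = 0\<close>. If \<open>d \<noteq> 0\<close>, both nonnegative summands vanish, and then
  so does their difference, which is \<open>d\<close> itself. Hence all eigenvalues of \<open>X\<close> vanish.\<close>
lemma psd_square_inj:
  assumes B: "B \<in> carrier_mat n n" "psd_mat B" and B': "B' \<in> carrier_mat n n" "psd_mat B'"
    and sq: "B * B = B' * B'"
  shows "B = B'"
proof -
  define X where "X = B - B'"
  have X: "X \<in> carrier_mat n n" unfolding X_def by (rule minus_carrier_mat[OF B'(1)])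
  have "mat_adjoint X = mat_adjoint B - mat_adjoint B'"
    using B B' by (intro eq_matI) (auto simp: X_def)
  then have "mat_adjoint X = X"
    using B B' by (simp add: X_def psd_mat_def hermitian_mat_def)
  from hermitian_spectral_decomposition[OF X this] obtain U and d :: "nat \<Rightarrow> real"
    where U: "unitary_mat n U" and XU: "X = diag_conj n U (\<lambda>i. of_real (d i))" .
  note c = unitary_matD[OF U]
  let ?D = "mat_diag n (\<lambda>i. complex_of_real (d i))"
  \<comment> \<open>\<open>B\<close> and \<open>B'\<close> in the eigenbasis of \<open>X\<close>\<close>
  let ?P = "mat_adjoint U * (B * U)" and ?P' = "mat_adjoint U * (B' * U)"
  have P: "?P \<in> carrier_mat n n" "?P' \<in> carrier_mat n n"
    using B B' c by (auto simp: mult_carrier_square_mat[where n = n])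
  have UX: "mat_adjoint U * X = ?D * mat_adjoint U"
    unfolding XU diag_conj_def using c
    by (simp add: assoc_mult_carrier_square_matuare_mat[where n = n] mult_carrier_square_mat[where n = n] unitary_cancel(1)[OF U, where m = n])
  have XU': "X * U = U * ?D"
    unfolding XU diag_conj_def using c
    by (simp add: assoc_mult_carrier_square_matuare_mat[where n = n] mult_carrier_square_mat[where n = n] right_mult_one_mat[OF mat_diag_dim])
  have diff: "?P - ?P' = ?D"
  proof -
    have "?P - ?P' = mat_adjoint U * (X * U)"
      unfolding X_def using B B' c
      by (simp add: minus_mult_distrib_mat[of _ n n _ _ n] mult_minus_distrib_mat[of _ n n _ n] mult_carrier_square_mat[where n = n])
    then show ?thesis unfolding XU' by (simp add: unitary_cancel(1)[OF U, where m = n])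
  qed
  have BX: "B * X = B * B - B * B'" "X * B' = B * B' - B' * B'"
    unfolding X_def using B B'
    by (simp_all add: minus_mult_distrib_mat[of _ n n _ _ n] mult_minus_distrib_mat[of _ n n _ n])
  have anti: "B * X = - (X * B')"
    unfolding BX sq using B(1) B'(1) by (intro eq_matI) auto
  have "?P * ?D = mat_adjoint U * ((B * X) * U)"
    using B X c by (simp add: assoc_mult_carrier_square_matuare_mat[where n = n] mult_carrier_square_mat[where n = n] XU')
  also have "\<dots> = - (mat_adjoint U * (X * (B' * U)))"
    unfolding anti using B' X c by (simp add: mult_carrier_square_mat[where n = n] assoc_mult_carrier_square_matuare_mat[where n = n])
  also have "mat_adjoint U * (X * (B' * U)) = (mat_adjoint U * X) * (B' * U)"
    using B' X c by (simp add: assoc_mult_carrier_square_matuare_mat[where n = n] mult_carrier_square_mat[where n = n])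
  also have "\<dots> = ?D * ?P'"
    unfolding UX using B' c by (simp add: assoc_mult_carrier_square_matuare_mat[where n = n] mult_carrier_square_mat[where n = n])
  finally have PD: "?P * ?D = - (?D * ?P')" .
  have "d k = 0" if k: "k < n" for k
  proof (rule ccontr)
    assume dk: "d k \<noteq> 0"
    have "?P $$ (k, k) * of_real (d k) = - (of_real (d k) * ?P' $$ (k, k))"
      using arg_cong[OF PD, of "\<lambda>M. M $$ (k, k)"] k P
      unfolding mat_diag_mult_left[OF P(2)] mat_diag_mult_right[OF P(1)]
      by (simp del: index_mult_mat(1))
    then have "of_real (d k) * (?P $$ (k, k) + ?P' $$ (k, k)) = 0"
      by (simp only: distrib_left mult.commute[of "of_real (d k)" "?P $$ (k, k)"]) simp
    with dk have "?P $$ (k, k) + ?P' $$ (k, k) = 0"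
      by (simp only: mult_eq_0_iff of_real_eq_0_iff simp_thms)
    from arg_cong[OF this, of Re] have "Re (?P $$ (k, k)) + Re (?P' $$ (k, k)) = 0"
      by (simp only: plus_complex.sel zero_complex.sel)
    moreover have "Re (?P $$ (k, k)) \<ge> 0" "Re (?P' $$ (k, k)) \<ge> 0"
      using psd_congruence_diagonal[OF B(2,1) c(1) k] psd_congruence_diagonal[OF B'(2,1) c(1) k] .
    moreover have "?P $$ (k, k) - ?P' $$ (k, k) = of_real (d k)"
      using arg_cong[OF diff, of "\<lambda>M. M $$ (k, k)"] k index_minus_mat(1)[of k ?P' k ?P] P
      by (simp add: mat_diag_def del: index_mult_mat)
    from arg_cong[OF this, of Re] have "Re (?P $$ (k, k)) - Re (?P' $$ (k, k)) = d k"
      by (simp only: minus_complex.sel Re_complex_of_real)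
    ultimately show False using dk by linarith
  qed
  then have "?D = 0\<^sub>m n n" by (intro eq_matI) (auto simp: mat_diag_def)
  then have X0: "X = 0\<^sub>m n n" unfolding XU diag_conj_def using c by simp
  show ?thesis
  proof (rule eq_matI)
    fix i j assume "i < dim_row B'" "j < dim_col B'"
    then show "B $$ (i, j) = B' $$ (i, j)"
      using arg_cong[OF X0, of "\<lambda>M. M $$ (i, j)"] B(1) B'(1) by (simp add: X_def)
  qed (use B(1) B'(1) in auto)
qed

lemma mat_abs_diag_conj:
  assumes U: "unitary_mat n U"
  shows "mat_abs (diag_conj n U (\<lambda>i. of_real (d i))) = diag_conj n U (\<lambda>i. of_real \<bar>d i\<bar>)"
proof -
  let ?A = "diag_conj n U (\<lambda>i. of_real (d i))" and ?H = "diag_conj n U (\<lambda>i. of_real \<bar>d i\<bar>)"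
  have H: "?H \<in> carrier_mat n n" "psd_mat ?H"
    using U psd_diag_conj[OF U, of "\<lambda>i. \<bar>d i\<bar>"] by auto
  have HH: "?H * ?H = ?A * mat_adjoint ?A"
    unfolding mat_adjoint_diag_conj[OF U] diag_conj_mult[OF U]
    by (simp only: complex_cnj_complex_of_real abs_mult_self_eq flip: of_real_mult)
  have dim: "dim_row (?A * mat_adjoint ?A) = n"
    using carrier_matD(1)[OF diag_conj_carrier[OF U, of "\<lambda>i. of_real (d i)"]] by simp
  show ?thesis
    unfolding mat_abs_def psd_sqrt_def dim
  proof (rule the_equality)
    show "?H \<in> carrier_mat n n \<and> psd_mat ?H \<and> ?H * ?H = ?A * mat_adjoint ?A"
      using H HH by blast
    fix B assume "B \<in> carrier_mat n n \<and> psd_mat B \<and> B * B = ?A * mat_adjoint ?A"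
    then show "B = ?H"
      using psd_square_inj[OF _ _ H] unfolding HH by blast
  qed
qed

section \<open>The trace inequality\<close>

text \<open>An instance of the duality between trace norm and operator norm: for a contraction \<open>V\<close> the
  real part of \<open>tr (V A)\<close> is at least minus the sum of the moduli of the eigenvalues of \<open>A\<close>, here
  with \<open>V = J S J\<close>. Passing to the eigenbasis turns \<open>J\<close> into the Hermitian unitary \<open>K = U* J U\<close> and
  the trace into \<open>\<Sum>k l. s l * d k * |K_kl|^2\<close>, and the squared moduli in each row of \<open>K\<close> sum
  to 1.\<close>
lemma mat_trace_signed_product_ge:
  assumes U: "unitary_mat n U" and J: "J \<in> carrier_mat n n" "mat_adjoint J = J" "J * J = 1\<^sub>m n"
    and s: "\<And>i. i < n \<Longrightarrow> \<bar>s i\<bar> \<le> (1 :: real)"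
  shows "Re (mat_trace ((J * diag_conj n U (\<lambda>i. of_real (s i))) * (J * diag_conj n U (\<lambda>i. of_real (d i)))))
    \<ge> - (\<Sum>i<n. \<bar>d i\<bar>)"
proof -
  note c = unitary_matD[OF U]
  let ?S = "mat_diag n (\<lambda>i. complex_of_real (s i))" and ?D = "mat_diag n (\<lambda>i. complex_of_real (d i))"
  define K where "K = mat_adjoint U * (J * U)"
  have K: "K \<in> carrier_mat n n"
    unfolding K_def using c J by (simp add: mult_carrier_square_mat[where n = n])
  have Kherm: "mat_adjoint K = K"
    unfolding K_def using c J
    by (simp add: mat_adjoint_mult[of _ n n _ n] mult_carrier_square_mat[where n = n] assoc_mult_carrier_square_matuare_mat[where n = n])
  have KK: "K * K = 1\<^sub>m n"
  proof -
    have "K * K = mat_adjoint U * (J * (U * (mat_adjoint U * (J * U))))"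
      unfolding K_def using c J by (simp add: mult_carrier_square_mat[where n = n] assoc_mult_carrier_square_matuare_mat[where n = n])
    also have "\<dots> = mat_adjoint U * (J * (J * U))"
      using c J by (subst unitary_cancel(2)[OF U, where m = n]) (auto simp: mult_carrier_square_mat[where n = n])
    also have "J * (J * U) = (J * J) * U"
      by (rule assoc_mult_mat[symmetric, OF J(1) J(1) c(1)])
    finally show ?thesis using c J(3) by simp
  qed
  have Ksym: "K $$ (l, k) = cnj (K $$ (k, l))" if "k < n" "l < n" for k l
    using mat_adjoint_index[of l K k] that K unfolding Kherm by simp
  have row1: "(\<Sum>l<n. (cmod (K $$ (k, l)))\<^sup>2) = 1" if k: "k < n" for k
  proof -
    have "1 = (K * K) $$ (k, k)" using k unfolding KK by simp
    also have "\<dots> = (\<Sum>l<n. K $$ (k, l) * cnj (K $$ (k, l)))"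
      unfolding index_mult_mat_sum[OF K K k k] using Ksym[OF k] by (intro sum.cong) auto
    also have "\<dots> = of_real (\<Sum>l<n. (cmod (K $$ (k, l)))\<^sup>2)"
      by (simp add: complex_norm_square del: of_real_power)
    finally show ?thesis by (metis of_real_eq_1_iff)
  qed
  have "mat_trace ((J * diag_conj n U (\<lambda>i. of_real (s i))) * (J * diag_conj n U (\<lambda>i. of_real (d i)))) =
      mat_trace ((J * (U * (?S * (mat_adjoint U * (J * (U * ?D)))))) * mat_adjoint U)"
    unfolding diag_conj_def using c J by (simp add: mult_carrier_square_mat[where n = n] assoc_mult_carrier_square_matuare_mat[where n = n])
  also have "\<dots> = mat_trace (mat_adjoint U * (J * (U * (?S * (mat_adjoint U * (J * (U * ?D)))))))"
    using c J by (intro mat_trace_comm[of _ n n]) (auto simp: mult_carrier_square_mat[where n = n])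
  also have "\<dots> = mat_trace ((K * ?S) * (K * ?D))"
    unfolding K_def using c J by (simp add: mult_carrier_square_mat[where n = n] assoc_mult_carrier_square_matuare_mat[where n = n])
  also have "\<dots> = (\<Sum>k<n. \<Sum>l<n. (K * ?S) $$ (k, l) * (K * ?D) $$ (l, k))"
  proof -
    have KS: "K * ?S \<in> carrier_mat n n" "K * ?D \<in> carrier_mat n n"
      using K by (auto simp: mult_carrier_square_mat[where n = n])
    have "dim_row ((K * ?S) * (K * ?D)) = n" using K by simp
    then show ?thesis
      unfolding mat_trace_def using index_mult_mat_sum[OF KS] by (intro sum.cong) auto
  qed
  also have "\<dots> = (\<Sum>k<n. \<Sum>l<n. of_real (s l * d k * (cmod (K $$ (k, l)))\<^sup>2))"
    unfolding mat_diag_mult_right[OF K]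
  proof (intro sum.cong refl)
    fix k l assume "k \<in> {..<n}" "l \<in> {..<n}"
    then have kl: "k < n" "l < n" by auto
    have "K $$ (k, l) * K $$ (l, k) = of_real ((cmod (K $$ (k, l)))\<^sup>2)"
      unfolding Ksym[OF kl] by (rule complex_norm_square[symmetric])
    then show "mat n n (\<lambda>(i, j). K $$ (i, j) * of_real (s j)) $$ (k, l) *
        mat n n (\<lambda>(i, j). K $$ (i, j) * of_real (d j)) $$ (l, k) =
        of_real (s l * d k * (cmod (K $$ (k, l)))\<^sup>2)"
      using kl by (simp add: mult_ac del: of_real_power)
  qed
  finally have tr: "Re (mat_trace ((J * diag_conj n U (\<lambda>i. of_real (s i))) * (J * diag_conj n U (\<lambda>i. of_real (d i))))) =
      (\<Sum>k<n. \<Sum>l<n. s l * d k * (cmod (K $$ (k, l)))\<^sup>2)"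
    by (simp del: of_real_mult of_real_power)
  have "- (\<Sum>k<n. \<bar>d k\<bar>) = (\<Sum>k<n. - \<bar>d k\<bar> * (\<Sum>l<n. (cmod (K $$ (k, l)))\<^sup>2))"
    by (simp add: row1 sum_negf)
  also have "\<dots> = (\<Sum>k<n. \<Sum>l<n. - \<bar>d k\<bar> * (cmod (K $$ (k, l)))\<^sup>2)"
    by (simp only: sum_distrib_left)
  also have "\<dots> \<le> (\<Sum>k<n. \<Sum>l<n. s l * d k * (cmod (K $$ (k, l)))\<^sup>2)"
  proof (intro sum_mono mult_right_mono)
    fix k l assume "k \<in> {..<n}" "l \<in> {..<n}"
    then have "\<bar>s l * d k\<bar> \<le> \<bar>d k\<bar>"
      using s[of l] by (simp add: abs_mult mult_left_le_one_le)
    then show "- \<bar>d k\<bar> \<le> s l * d k" by linarith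
  qed simp
  finally show ?thesis unfolding tr .
qed

text \<open>The heart of the argument. Let \<open>W\<close> be the sign of \<open>A\<close> and \<open>J\<close> the diagonal matrix of the signs
  \<open>\<epsilon>\<close>, so that \<open>|A| = W A = A W\<close>. Averaging these two expressions gives \<open>\<epsilon> i + \<epsilon> j\<close> as the
  coefficient of \<open>W_ij A_ji\<close> in \<open>2 tr (J |A|)\<close>. For signs, \<open>\<epsilon> i + \<epsilon> j = 1 + \<epsilon> i \<epsilon> j\<close> unless both
  are \<open>- 1\<close>, and there \<open>A\<close> vanishes. Hence \<open>2 tr (J |A|) = tr (W A) + tr (J W J A)\<close>, where the first
  trace is \<open>tr |A|\<close> and the second is at least \<open>- tr |A|\<close>.\<close>
lemma signed_abs_diagonal_nonneg:
  fixes \<epsilon> :: "nat \<Rightarrow> real"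
  assumes A: "A \<in> carrier_mat n n" "mat_adjoint A = A"
    and \<epsilon>: "\<And>i. i < n \<Longrightarrow> \<epsilon> i = 1 \<or> \<epsilon> i = - 1"
    and indep: "\<And>i j. i < n \<Longrightarrow> j < n \<Longrightarrow> \<epsilon> i = - 1 \<Longrightarrow> \<epsilon> j = - 1 \<Longrightarrow> A $$ (i, j) = 0"
  shows "(\<Sum>i<n. \<epsilon> i * Re (mat_abs A $$ (i, i))) \<ge> 0"
proof -
  from hermitian_spectral_decomposition[OF A] obtain U and d :: "nat \<Rightarrow> real"
    where U: "unitary_mat n U" and AU: "A = diag_conj n U (\<lambda>i. of_real (d i))" .
  define H where "H = mat_abs A"
  have H: "H = diag_conj n U (\<lambda>i. of_real \<bar>d i\<bar>)"
    unfolding H_def AU by (rule mat_abs_diag_conj[OF U])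
  define W where "W = diag_conj n U (\<lambda>i. of_real (sgn (d i)))"
  have W: "W \<in> carrier_mat n n" unfolding W_def by (rule diag_conj_carrier[OF U])
  have WA: "H = W * A" and AW: "H = A * W"
    unfolding H W_def AU diag_conj_mult[OF U]
    by (simp_all add: abs_sgn mult.commute)
  define J where "J = mat_diag n (\<lambda>i. complex_of_real (\<epsilon> i))"
  have J: "J \<in> carrier_mat n n" by (simp add: J_def)
  have "mat_adjoint J = J" by (simp add: J_def mat_adjoint_diag)
  moreover have "J * J = 1\<^sub>m n"
    unfolding J_def mat_diag_diag
  proof (rule eq_matI)
    fix i j assume "i < dim_row (1\<^sub>m n :: complex mat)" "j < dim_col (1\<^sub>m n :: complex mat)"
    then show "mat_diag n (\<lambda>i. complex_of_real (\<epsilon> i) * of_real (\<epsilon> i)) $$ (i, j) = 1\<^sub>m n $$ (i, j)"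
      using \<epsilon>[of j] by (auto simp: mat_diag_def)
  qed (auto simp: mat_diag_def)
  ultimately have "Re (mat_trace ((J * W) * (J * A))) \<ge> - (\<Sum>i<n. \<bar>d i\<bar>)"
    unfolding W_def AU by (intro mat_trace_signed_product_ge[OF U J]) (auto simp: sgn_if)
  moreover have "Re (mat_trace H) = (\<Sum>i<n. \<bar>d i\<bar>)"
    unfolding H mat_trace_diag_conj[OF U] by simp
  moreover have "2 * (\<Sum>i<n. of_real (\<epsilon> i) * H $$ (i, i)) = mat_trace H + mat_trace ((J * W) * (J * A))"
  proof -
    have JW: "J * W \<in> carrier_mat n n" "J * A \<in> carrier_mat n n"
      using J W A by (auto simp: mult_carrier_square_mat[where n = n])
    have dims: "dim_row H = n" "dim_row ((J * W) * (J * A)) = n"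
      using WA W J by auto
    have 1: "H $$ (i, i) = (\<Sum>j<n. W $$ (i, j) * A $$ (j, i))" if "i < n" for i
      unfolding WA by (rule index_mult_mat_sum[OF W A(1) that that])
    have 2: "H $$ (j, j) = (\<Sum>i<n. W $$ (i, j) * A $$ (j, i))" if "j < n" for j
      unfolding AW index_mult_mat_sum[OF A(1) W that that] by (simp only: mult.commute)
    have 3: "((J * W) * (J * A)) $$ (i, i) =
        (\<Sum>j<n. of_real (\<epsilon> i * \<epsilon> j) * (W $$ (i, j) * A $$ (j, i)))" if "i < n" for i
      unfolding index_mult_mat_sum[OF JW that that]
      unfolding J_def mat_diag_mult_left[OF W] mat_diag_mult_left[OF A(1)]
      using that by (intro sum.cong) auto
    have rows: "(\<Sum>i<n. of_real (\<epsilon> i) * H $$ (i, i)) =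
        (\<Sum>i<n. \<Sum>j<n. of_real (\<epsilon> i) * (W $$ (i, j) * A $$ (j, i)))"
      by (intro sum.cong refl) (simp add: 1 sum_distrib_left)
    have cols: "(\<Sum>i<n. of_real (\<epsilon> i) * H $$ (i, i)) =
        (\<Sum>i<n. \<Sum>j<n. of_real (\<epsilon> j) * (W $$ (i, j) * A $$ (j, i)))"
      by (subst sum.swap, intro sum.cong refl) (simp add: 2 sum_distrib_left)
    have "2 * (\<Sum>i<n. of_real (\<epsilon> i) * H $$ (i, i)) =
        (\<Sum>i<n. \<Sum>j<n. of_real (\<epsilon> i) * (W $$ (i, j) * A $$ (j, i))) +
        (\<Sum>i<n. \<Sum>j<n. of_real (\<epsilon> j) * (W $$ (i, j) * A $$ (j, i)))"
      using arg_cong2[OF rows cols, of "(+)"] by (simp only: mult_2)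
    also have "\<dots> = (\<Sum>i<n. \<Sum>j<n. of_real (\<epsilon> i + \<epsilon> j) * (W $$ (i, j) * A $$ (j, i)))"
      by (simp add: sum.distrib distrib_right)
    also have "\<dots> = (\<Sum>i<n. \<Sum>j<n. of_real (1 + \<epsilon> i * \<epsilon> j) * (W $$ (i, j) * A $$ (j, i)))"
    proof (intro sum.cong refl)
      fix i j assume "i \<in> {..<n}" "j \<in> {..<n}"
      then have ij: "i < n" "j < n" by auto
      show "of_real (\<epsilon> i + \<epsilon> j) * (W $$ (i, j) * A $$ (j, i)) =
          of_real (1 + \<epsilon> i * \<epsilon> j) * (W $$ (i, j) * A $$ (j, i))"
      proof (cases "\<epsilon> i = - 1 \<and> \<epsilon> j = - 1")
        case True
        then show ?thesis using indep[OF ij(2,1)] by simp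
      next
        case False
        then have "\<epsilon> i + \<epsilon> j = 1 + \<epsilon> i * \<epsilon> j"
          using \<epsilon>[OF ij(1)] \<epsilon>[OF ij(2)] by auto
        then show ?thesis by (simp only:)
      qed
    qed
    also have "\<dots> = (\<Sum>i<n. H $$ (i, i)) + (\<Sum>i<n. ((J * W) * (J * A)) $$ (i, i))"
      by (simp add: 1 3 sum.distrib distrib_right del: index_mult_mat(1))
    finally show ?thesis unfolding mat_trace_def dims .
  qed
  ultimately have "0 \<le> Re (2 * (\<Sum>i<n. of_real (\<epsilon> i) * H $$ (i, i)))" by simp
  then show ?thesis unfolding H_def by simp
qed

section \<open>Energy of a graph on a vertex cover\<close>

lemma sum_mat_abs_diagonal:
  assumes A: "A \<in> carrier_mat n n" "mat_adjoint A = A"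
  shows "(\<Sum>i<n. Re (mat_abs A $$ (i, i))) = (\<Sum>z\<in>#proots (char_poly A). cmod z)"
proof -
  from hermitian_spectral_decomposition[OF A] obtain U and d :: "nat \<Rightarrow> real"
    where U: "unitary_mat n U" and AU: "A = diag_conj n U (\<lambda>i. of_real (d i))" .
  have "(\<Sum>i<n. Re (mat_abs A $$ (i, i))) = Re (mat_trace (mat_abs A))"
    using carrier_matD(1)[OF diag_conj_carrier[OF U, of "\<lambda>i. of_real \<bar>d i\<bar>"]]
    unfolding AU mat_abs_diag_conj[OF U] mat_trace_def by simp
  also have "\<dots> = (\<Sum>i<n. \<bar>d i\<bar>)"
    unfolding AU mat_abs_diag_conj[OF U] mat_trace_diag_conj[OF U] by simp
  also have "\<dots> = (\<Sum>z\<in>#proots (char_poly A). cmod z)"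
    unfolding AU proots_char_poly_diag_conj[OF U]
    by (simp add: image_mset.compositionality o_def sum_unfold_sum_mset lessThan_atLeast0)
  finally show ?thesis .
qed

theorem theorem4p5:
  fixes G :: "'a pair_pre_digraph" and vs :: "'a list" and C :: "'a set"
  assumes "pair_graph G"
    and "bipartite G"
    and "distinct vs" and "set vs = pverts G"
    and "vertex_cover G C"
  shows "(\<Sum>i | i < length vs \<and> vs ! i \<in> C. vertex_energy G vs i) \<ge> 1 / 2 * graph_energy G vs"
proof -
  interpret pair_graph G by fact
  define n where "n = length vs"
  define A where "A = adjacency_matrix G vs"
  have A: "A \<in> carrier_mat n n" by (simp add: A_def adjacency_matrix_def n_def)
  have herm: "mat_adjoint A = A"
    by (rule eq_matI) (auto simp: A_def adjacency_matrix_def dest: arcs_symmetric)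
  \<comment> \<open>\<open>\<epsilon> i = - 1\<close> marks the complement of the cover, an independent set.\<close>
  define \<epsilon> where "\<epsilon> i = (if vs ! i \<in> C then 1 else - 1 :: real)" for i
  define E where "E i = vertex_energy G vs i" for i
  have E: "E i = Re (mat_abs A $$ (i, i))" for i
    by (simp add: E_def vertex_energy_def A_def)
  have "0 \<le> (\<Sum>i<n. \<epsilon> i * E i)"
    unfolding E
  proof (rule signed_abs_diagonal_nonneg[OF A herm])
    fix i j assume "i < n" "j < n" "\<epsilon> i = - 1" "\<epsilon> j = - 1"
    then show "A $$ (i, j) = 0"
      using \<open>vertex_cover G C\<close>
      by (auto simp: A_def adjacency_matrix_def n_def \<epsilon>_def vertex_cover_def split: if_splits)
  qed (auto simp: \<epsilon>_def)
  moreover have "(\<Sum>i<n. E i) = graph_energy G vs"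
    unfolding E graph_energy_def A_def[symmetric] by (rule sum_mat_abs_diagonal[OF A herm])
  moreover have "(\<Sum>i<n. \<epsilon> i * E i) + (\<Sum>i<n. E i) = 2 * (\<Sum>i | i < n \<and> vs ! i \<in> C. E i)"
  proof -
    have "(\<Sum>i<n. \<epsilon> i * E i) + (\<Sum>i<n. E i) = (\<Sum>i<n. if vs ! i \<in> C then 2 * E i else 0)"
      unfolding sum.distrib[symmetric] by (intro sum.cong) (auto simp: \<epsilon>_def)
    also have "\<dots> = (\<Sum>i | i < n \<and> vs ! i \<in> C. 2 * E i)"
      by (simp add: sum.If_cases Int_def)
    finally show ?thesis by (simp add: sum_distrib_left)
  qed
  ultimately show ?thesis unfolding n_def E_def by linarith
qed

end
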